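(* Let $p \geq 1$ be a real number. A Banach lattice $E$ has the positive Schur property of order $p$ ($SP_p^+$) if and only if $E$ has order continuous norm and the disjoint Dunford-Pettis* property of order $p$ (disjoint $DP^\ast P_p$).
   Context: A sequence $(x_n)_n$ in a Banach lattice is disjoint if $|x_n| \wedge |x_m| = 0$ whenever $n \neq m$. A sequence $(x_n)_n$ in a Banach space $X$ is weakly $p$-summable if $\sum_n |x^\ast(x_n)|^p < \infty$ for every $x^\ast \in X^\ast$. A Banach lattice has the positive Schur property of order $p$ ($SP_p^+$) if and only if every disjoint weakly $p$-summable sequence in it is norm null. A subset $A$ of a Banach space $X$ is limited if every weak* null sequence in $X^\ast$ converges uniformly to zero on $A$. A Banach lattice $E$ has the disjoint Dunford-Pettis* property of order $p$ (disjoint $DP^\ast P_p$) if, for every disjoint weakly $p$-summable sequence $(x_n)_n$ in $E$, the set $\{x_n : n \in \mathbb{N}\}$ is limited. *)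

theory Defs
  imports "HOL-Analysis.Analysis" "HOL-Library.Lattice_Algebras"
begin

text \<open>Real Banach lattices. The law \<open>\<bar>x\<bar> = sup x (- x)\<close> comes from
  \<^class>\<open>lattice_ab_group_add_abs\<close>; compatibility of the order with nonnegative scalars comes
  from \<^class>\<open>ordered_real_vector\<close>.\<close>

class banach_lattice = banach + ordered_real_vector + lattice_ab_group_add_abs +
  assumes lattice_norm_mono: "\<bar>x\<bar> \<le> \<bar>y\<bar> \<Longrightarrow> norm x \<le> norm y"

instance real :: banach_lattice
  by standard simp

definition disjoint_seq :: "(nat \<Rightarrow> 'a::banach_lattice) \<Rightarrow> bool"
  where "disjoint_seq x \<longleftrightarrow> (\<forall>m n. n \<noteq> m \<longrightarrow> inf \<bar>x n\<bar> \<bar>x m\<bar> = 0)"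

definition weakly_p_summable :: "real \<Rightarrow> (nat \<Rightarrow> 'a::banach) \<Rightarrow> bool"
  where "weakly_p_summable p x \<longleftrightarrow>
    (\<forall>f :: 'a \<Rightarrow>\<^sub>L real. summable (\<lambda>n. \<bar>blinfun_apply f (x n)\<bar> powr p))"

definition weak_star_null :: "(nat \<Rightarrow> 'a::banach \<Rightarrow>\<^sub>L real) \<Rightarrow> bool"
  where "weak_star_null f \<longleftrightarrow> (\<forall>x. (\<lambda>n. blinfun_apply (f n) x) \<longlonglongrightarrow> 0)"

definition limited_set :: "'a::banach set \<Rightarrow> bool"
  where "limited_set A \<longleftrightarrow>
    (\<forall>f. weak_star_null f \<longrightarrow>
      uniform_limit A (\<lambda>n. blinfun_apply (f n)) (\<lambda>_. 0) sequentially)"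

definition positive_Schur :: "real \<Rightarrow> 'a::banach_lattice itself \<Rightarrow> bool"
  where "positive_Schur p (_ :: 'a itself) \<longleftrightarrow>
    (\<forall>x :: nat \<Rightarrow> 'a. disjoint_seq x \<longrightarrow> weakly_p_summable p x \<longrightarrow> (\<lambda>n. norm (x n)) \<longlonglongrightarrow> 0)"

definition disjoint_DP_star :: "real \<Rightarrow> 'a::banach_lattice itself \<Rightarrow> bool"
  where "disjoint_DP_star p (_ :: 'a itself) \<longleftrightarrow>
    (\<forall>x :: nat \<Rightarrow> 'a. disjoint_seq x \<longrightarrow> weakly_p_summable p x \<longrightarrow> limited_set (range x))"

text \<open>\<open>decreases_to_zero D\<close> is \<open>D \<down> 0\<close>: the set \<open>D\<close> is nonempty and downward directed, with greatest
  lower bound \<open>0\<close>.\<close>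

definition decreases_to_zero :: "'a::banach_lattice set \<Rightarrow> bool"
  where "decreases_to_zero D \<longleftrightarrow>
    D \<noteq> {} \<and> (\<forall>x\<in>D. \<forall>y\<in>D. \<exists>z\<in>D. z \<le> x \<and> z \<le> y) \<and>
    (\<forall>x\<in>D. 0 \<le> x) \<and> (\<forall>l. (\<forall>x\<in>D. l \<le> x) \<longrightarrow> l \<le> 0)"

text \<open>Order continuity of the norm: every net decreasing to \<open>0\<close> is norm null. A decreasing net is
  represented by its range \<open>D\<close>, indexed by itself under the reversed order; this loses nothing
  because the norm is monotone on positive elements, and it avoids quantifying over index types.\<close>

definition order_continuous_norm :: "'a::banach_lattice itself \<Rightarrow> bool"
  where "order_continuous_norm (_ :: 'a itself) \<longleftrightarrow>
    (\<forall>D :: 'a set. decreases_to_zero D \<longrightarrow>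
      (\<forall>e>0. \<exists>x\<in>D. \<forall>y\<in>D. y \<le> x \<longrightarrow> norm y < e))"

end

theory Submission
  imports Defs
begin

text \<open>The limited sets enter through two facts. The range of a norm null sequence is limited, because a
  weak* null sequence of functionals is bounded (\<open>banach_steinhaus\<close>); so the positive Schur property
  trivially gives the disjoint Dunford-Pettis* property. Conversely, to see that a disjoint weakly
  \<open>p\<close>-summable sequence \<open>x\<close> with limited range is norm null, it suffices to find a weak* null
  sequence \<open>f\<close> with \<open>f n (x n) = norm (x n)\<close>. Order continuity provides it: let \<open>f n\<close> live on the
  band generated by \<open>x n\<close>. Then \<open>f n y\<close> is controlled by the part of \<open>\<bar>y\<bar>\<close> in that band. These parts
  are disjoint and lie below \<open>\<bar>y\<bar>\<close>, and under order continuity such sequences are norm null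
  (\<open>order_continuous_norm_disjoint_null\<close>). The functionals come from a Hahn-Banach
  theorem applied to \<open>band_seminorm\<close>, which measures the part in the band without a band projection.

  That the positive Schur property implies order continuity rests on the observation that a disjoint
  sequence in an order interval \<open>[0, x]\<close> is weakly \<open>p\<close>-summable
  (\<open>weakly_p_summable_disjoint_order_bounded\<close>), hence norm null. It remains to show that this forces
  every set decreasing to zero to contain elements of small norm. If not, the
  set is not a Cauchy net, as its limit would be its infimum zero, so it contains a decreasing sequence
  with differences bounded away from zero. These are positive and have
  bounded sums, and \<open>disjoint_sequence_of_bounded_positive_series\<close> extracts from them a disjoint
  sequence in an order interval that is not norm null, a contradiction. The extraction is the main work.
  Cutting off a small multiple of \<open>x\<close> from the terms leaves excesses of which only
  boundedly many can have a common part, just as only boundedly many functions with sum at most \<open>1\<close> can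
  exceed \<open>\<epsilon>\<close> at the same point. A maximal common part that still meets the excesses substantially then
  meets them in asymptotically disjoint pieces, which a small perturbation makes disjoint.\<close>

section \<open>Banach lattices\<close>

lemma norm_abs_lattice: "norm \<bar>x\<bar> = norm (x::'a::banach_lattice)"
  by (rule antisym) (rule lattice_norm_mono, simp)+

lemma norm_mono_nonneg:
  fixes x y :: "'a::banach_lattice"
  assumes "0 \<le> x" "x \<le> y"
  shows "norm x \<le> norm y"
proof -
  have "0 \<le> y"
    using assms by (rule order_trans)
  then show ?thesis
    using assms by (intro lattice_norm_mono) (simp add: abs_of_nonneg)
qed

lemma norm_pprt_le: "norm (pprt x) \<le> norm (x::'a::banach_lattice)"
proof -
  have "pprt x \<le> \<bar>x\<bar>"
    by (simp add: pprt_def abs_ge_self)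
  then have "norm (pprt x) \<le> norm \<bar>x\<bar>"
    by (intro norm_mono_nonneg) auto
  then show ?thesis
    by (simp add: norm_abs_lattice)
qed

lemma pprt_add_le: "pprt (x + y) \<le> pprt x + pprt (y::'a::lattice_ab_group_add)"
  unfolding pprt_def
  by (intro sup_least add_mono add_nonneg_nonneg) auto

lemma inf_add_le:
  fixes a b c :: "'a::lattice_ab_group_add"
  assumes "0 \<le> a" "0 \<le> b" "0 \<le> c"
  shows "inf (a + b) c \<le> inf a c + inf b c"
proof -
  have "inf (a + b) c - inf b c = sup (inf (a + b) c - b) (inf (a + b) c - c)"
    by (simp add: diff_inf_eq_sup add_sup_distrib_left)
  also have "\<dots> \<le> inf a c"
  proof (intro sup_least inf_greatest)
    have "inf (a + b) c \<le> a + b"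
      by simp
    then show "inf (a + b) c - b \<le> a"
      by (simp add: diff_le_eq)
    have c: "inf (a + b) c \<le> c"
      by simp
    then show "inf (a + b) c - b \<le> c"
      using assms by (simp add: diff_le_eq add_increasing2)
    show "inf (a + b) c - c \<le> a"
      using c assms by (simp add: diff_le_eq add_increasing)
    show "inf (a + b) c - c \<le> c"
      using c assms by (simp add: diff_le_eq add_increasing)
  qed
  finally show ?thesis
    by (simp only: diff_le_eq)
qed

lemma closed_positive_cone: "closed {x::'a::banach_lattice. 0 \<le> x}"
proof (unfold closed_sequential_limits, intro allI impI, elim conjE)
  fix s and l :: 'a
  assume s: "\<forall>n. s n \<in> {x. 0 \<le> x}" and lim: "s \<longlonglongrightarrow> l"
  \<comment> \<open>The negative part of \<open>l\<close> is dominated by the distance of \<open>l\<close> to any positive element.\<close>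
  have bound: "norm (pprt (- l)) \<le> norm (s n - l)" for n
  proof -
    have "pprt (- l) \<le> pprt (s n - l)"
      using s by (intro pprt_mono) simp
    then have "norm (pprt (- l)) \<le> norm (pprt (s n - l))"
      by (intro norm_mono_nonneg) auto
    then show ?thesis
      using norm_pprt_le order_trans by blast
  qed
  have "(\<lambda>n. norm (s n - l)) \<longlonglongrightarrow> 0"
    using lim by (simp add: LIM_zero tendsto_norm_zero)
  then have "norm (pprt (- l)) \<le> 0"
    using bound by (intro LIMSEQ_le_const) auto
  then show "l \<in> {x. 0 \<le> x}"
    by (simp add: le_zero_iff_zero_pprt[symmetric])
qed

lemma banach_lattice_lim_le:
  fixes s t :: "nat \<Rightarrow> 'a::banach_lattice"
  assumes "s \<longlonglongrightarrow> l" "t \<longlonglongrightarrow> m" "\<And>n. s n \<le> t n"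
  shows "l \<le> m"
proof -
  have "(\<lambda>n. t n - s n) \<longlonglongrightarrow> m - l"
    by (intro tendsto_diff assms)
  then have "m - l \<in> {x. 0 \<le> x}"
    by (rule closed_sequentially[OF closed_positive_cone, rotated]) (use assms(3) in simp)
  then show ?thesis
    by simp
qed

lemma banach_lattice_archimedean:
  fixes l v :: "'a::banach_lattice"
  assumes "\<And>k::nat. real k *\<^sub>R l \<le> v"
  shows "l \<le> 0"
proof (rule banach_lattice_lim_le)
  show "(\<lambda>n. l) \<longlonglongrightarrow> l"
    by simp
  have "(\<lambda>n. inverse (real (Suc n)) *\<^sub>R v) \<longlonglongrightarrow> 0 *\<^sub>R v"
    by (intro tendsto_scaleR LIMSEQ_inverse_real_of_nat tendsto_const)
  then show "(\<lambda>n. inverse (real (Suc n)) *\<^sub>R v) \<longlonglongrightarrow> 0"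
    by simp
  fix n
  have "inverse (real (Suc n)) *\<^sub>R real (Suc n) *\<^sub>R l \<le> inverse (real (Suc n)) *\<^sub>R v"
    by (intro scaleR_left_mono assms) simp
  then show "l \<le> inverse (real (Suc n)) *\<^sub>R v"
    by simp
qed

section \<open>Disjoint order bounded sequences\<close>

lemma sum_disjoint:
  fixes d :: "nat \<Rightarrow> 'a::banach_lattice"
  assumes nonneg: "\<And>n. 0 \<le> d n" and le: "\<And>n. d n \<le> x" and disj: "\<And>m n. n \<noteq> m \<Longrightarrow> inf (d n) (d m) = 0"
  shows sum_disjoint_inf: "N \<le> n \<Longrightarrow> inf (\<Sum>k<N. d k) (d n) = 0"
    and sum_disjoint_le: "(\<Sum>k<N. d k) \<le> x"
proof -
  have inf0: "inf (\<Sum>k<N. d k) (d n) = 0" if "N \<le> n" for N n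
    using that
  proof (induction N)
    case 0
    then show ?case
      using nonneg by (simp add: inf_absorb1)
  next
    case (Suc N)
    have "inf ((\<Sum>k<N. d k) + d N) (d n) \<le> inf (\<Sum>k<N. d k) (d n) + inf (d N) (d n)"
      by (intro inf_add_le sum_nonneg nonneg)
    also have "\<dots> = 0"
      using Suc disj[of N n] by simp
    finally show ?case
      by (intro antisym) (simp_all add: nonneg sum_nonneg add_nonneg_nonneg)
  qed
  then show "N \<le> n \<Longrightarrow> inf (\<Sum>k<N. d k) (d n) = 0" .
  show "(\<Sum>k<N. d k) \<le> x"
  proof (induction N)
    case 0
    show ?case
      using nonneg[of 0] le[of 0] by simp
  next
    case (Suc N)
    have "(\<Sum>k<N. d k) + d N = sup (\<Sum>k<N. d k) (d N)"
      using add_eq_inf_sup[of "\<Sum>k<N. d k" "d N"] inf0[of N N] by simp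
    also have "\<dots> \<le> x"
      using Suc le by simp
    finally show ?case
      by simp
  qed
qed

text \<open>A bounded functional \<open>f\<close> sees a signed partial sum of a disjoint sequence in the order interval
  \<open>[0, x]\<close> as an element of norm at most \<open>norm x\<close>, because its modulus is again at most \<open>x\<close>. Choosing
  the signs to match those of the values of \<open>f\<close> bounds the sum of their absolute values.\<close>

lemma weakly_p_summable_disjoint_order_bounded:
  fixes d :: "nat \<Rightarrow> 'a::banach_lattice"
  assumes "1 \<le> p"
    and nonneg: "\<And>n. 0 \<le> d n" and le: "\<And>n. d n \<le> x" and disj: "\<And>m n. n \<noteq> m \<Longrightarrow> inf (d n) (d m) = 0"
  shows "weakly_p_summable p d"
  unfolding weakly_p_summable_def
proof
  fix f :: "'a \<Rightarrow>\<^sub>L real"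
  have "(\<Sum>k<N. \<bar>f (d k)\<bar>) \<le> norm f * norm x" for N
  proof -
    have sgn_bound: "\<bar>sgn (f (d k)) *\<^sub>R d k\<bar> \<le> d k" for k
      using nonneg[of k] by (simp add: sgn_if abs_of_nonneg)
    have "\<bar>\<Sum>k<N. sgn (f (d k)) *\<^sub>R d k\<bar> \<le> (\<Sum>k<N. d k)"
      by (rule order_trans[OF sum_abs]) (intro sum_mono sgn_bound)
    also have "\<dots> \<le> x"
      by (rule sum_disjoint_le[OF nonneg le disj])
    also have "x \<le> \<bar>x\<bar>"
      by (rule abs_ge_self)
    finally have norm_le: "norm (\<Sum>k<N. sgn (f (d k)) *\<^sub>R d k) \<le> norm x"
      by (rule lattice_norm_mono)
    have "(\<Sum>k<N. \<bar>f (d k)\<bar>) = f (\<Sum>k<N. sgn (f (d k)) *\<^sub>R d k)"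
      by (simp add: blinfun.sum_right blinfun.scaleR_right abs_sgn mult.commute)
    also have "\<dots> \<le> norm (f (\<Sum>k<N. sgn (f (d k)) *\<^sub>R d k))"
      by simp
    also have "\<dots> \<le> norm f * norm (\<Sum>k<N. sgn (f (d k)) *\<^sub>R d k)"
      by (rule norm_blinfun)
    also have "\<dots> \<le> norm f * norm x"
      by (intro mult_left_mono norm_le) simp
    finally show ?thesis .
  qed
  then have "summable (\<lambda>k. \<bar>f (d k)\<bar>)"
    by (intro bounded_imp_summable[where B = "norm f * norm x"])
      (simp_all only: abs_ge_zero flip: lessThan_Suc_atMost)
  moreover have "\<forall>\<^sub>F k in sequentially. norm (\<bar>f (d k)\<bar> powr p) \<le> \<bar>f (d k)\<bar>"
  proof -
    have "(\<lambda>k. \<bar>f (d k)\<bar>) \<longlonglongrightarrow> 0"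
      by (rule summable_LIMSEQ_zero) fact
    then have "\<forall>\<^sub>F k in sequentially. \<bar>f (d k)\<bar> < 1"
      by (rule order_tendstoD) simp
    then show ?thesis
    proof eventually_elim
      case (elim k)
      have "\<bar>f (d k)\<bar> powr p \<le> \<bar>f (d k)\<bar> powr 1"
        using elim \<open>1 \<le> p\<close> by (intro powr_mono') auto
      then show ?case
        by simp
    qed
  qed
  ultimately show "summable (\<lambda>k. \<bar>f (d k)\<bar> powr p)"
    by (rule summable_comparison_test_ev[rotated])
qed

text \<open>With \<open>s\<close> the partial sums of \<open>d\<close>, the differences between upper bounds of \<open>s\<close> and terms of \<open>s\<close>
  form a set decreasing to zero: subtracting a lower bound of this set from an upper bound of \<open>s\<close> gives
  another upper bound, so by the Archimedean property such a lower bound cannot be positive. Each \<open>d n\<close>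
  with \<open>n\<close> large lies below a small element of this set.\<close>

lemma order_continuous_norm_disjoint_null:
  fixes d :: "nat \<Rightarrow> 'a::banach_lattice"
  assumes oc: "order_continuous_norm TYPE('a)"
    and nonneg: "\<And>n. 0 \<le> d n" and le: "\<And>n. d n \<le> x" and disj: "\<And>m n. n \<noteq> m \<Longrightarrow> inf (d n) (d m) = 0"
  shows "(\<lambda>n. norm (d n)) \<longlonglongrightarrow> 0"
proof -
  define s where "s n = (\<Sum>k<n. d k)" for n
  define U where "U = {u. \<forall>n. s n \<le> u}"
  define D where "D = {u - s n | u n. u \<in> U}"
  have s_mono: "s m \<le> s n" if "m \<le> n" for m n
    unfolding s_def using that nonneg by (intro sum_mono2) auto
  have "x \<in> U"
    unfolding U_def s_def using sum_disjoint_le[OF nonneg le disj] by auto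
  have "decreases_to_zero D"
    unfolding decreases_to_zero_def
  proof (intro conjI ballI allI impI)
    show "D \<noteq> {}"
      using \<open>x \<in> U\<close> unfolding D_def by blast
  next
    fix a b
    assume "a \<in> D" "b \<in> D"
    then obtain u m v n where ab: "u \<in> U" "v \<in> U" "a = u - s m" "b = v - s n"
      unfolding D_def by blast
    have "inf u v \<in> U"
      using ab unfolding U_def by simp
    then have "inf u v - s (max m n) \<in> D"
      unfolding D_def by blast
    moreover have "inf u v - s (max m n) \<le> a" "inf u v - s (max m n) \<le> b"
      unfolding ab by (auto intro!: diff_mono s_mono)
    ultimately show "\<exists>z\<in>D. z \<le> a \<and> z \<le> b"
      by blast
  next
    fix a
    assume "a \<in> D"
    then show "0 \<le> a"
      unfolding D_def U_def by auto
  next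
    fix l
    assume lb: "\<forall>a\<in>D. l \<le> a"
    \<comment> \<open>If \<open>u\<close> is an upper bound of \<open>s\<close>, then \<open>l \<le> u - s n\<close> for all \<open>n\<close>, so \<open>u - l\<close> is one too.\<close>
    have "x - real k *\<^sub>R l \<in> U" for k
    proof (induction k)
      case 0
      then show ?case
        using \<open>x \<in> U\<close> by simp
    next
      case (Suc k)
      have "s n \<le> x - real (Suc k) *\<^sub>R l" for n
      proof -
        have "l \<le> x - real k *\<^sub>R l - s n"
          using lb Suc unfolding D_def by blast
        then show ?thesis
          by (simp add: algebra_simps)
      qed
      then show ?case
        unfolding U_def by simp
    qed
    then have "s 0 \<le> x - real k *\<^sub>R l" for k
      unfolding U_def by blast
    then show "l \<le> 0"
      by (intro banach_lattice_archimedean[of l x]) (simp add: s_def)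
  qed
  show ?thesis
  proof (rule LIMSEQ_I)
    fix e :: real
    assume "0 < e"
    then obtain z where z: "z \<in> D" "\<And>y. y \<in> D \<Longrightarrow> y \<le> z \<Longrightarrow> norm y < e"
      using oc \<open>decreases_to_zero D\<close> unfolding order_continuous_norm_def by metis
    then obtain u N where u: "u \<in> U" "z = u - s N"
      unfolding D_def by blast
    have "norm (d n) < e" if "N \<le> n" for n
    proof -
      have "u - s n \<in> D" "u - s n \<le> z"
        unfolding D_def using u s_mono[OF that] by auto
      then have "norm (u - s n) < e"
        by (rule z(2))
      moreover have "s n + d n \<le> u"
        using u(1) unfolding U_def s_def by (metis (mono_tags, lifting) mem_Collect_eq sum.lessThan_Suc)
      then have "norm (d n) \<le> norm (u - s n)"
        by (intro norm_mono_nonneg nonneg) (simp add: le_diff_eq add.commute)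
      ultimately show ?thesis
        by simp
    qed
    then show "\<exists>N. \<forall>n\<ge>N. norm (norm (d n) - 0) < e"
      by auto
  qed
qed

section \<open>Uniform boundedness and limited sets\<close>

text \<open>By the Baire category theorem some set \<open>{x. \<forall>n. norm (f n x) \<le> N}\<close> has an interior point.
  Differences of values on a ball around it then bound all \<open>f n\<close> on the ball of the same radius around
  zero.\<close>

lemma banach_steinhaus:
  fixes f :: "nat \<Rightarrow> 'a::banach \<Rightarrow>\<^sub>L 'b::real_normed_vector"
  assumes ptw: "\<And>x. bounded (range (\<lambda>n. f n x))"
  shows "bounded (range f)"
proof -
  define A where "A N = {x. \<forall>n. norm (f n x) \<le> real N}" for N :: nat
  have closed_A: "closed (A N)" for N
  proof -
    have "A N = (\<Inter>n. {x. norm (f n x) \<le> real N})"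
      unfolding A_def by auto
    also have "closed \<dots>"
      by (intro closed_INT ballI closed_Collect_le continuous_intros)
    finally show ?thesis .
  qed
  have cover: "(\<Union>N. A N) = UNIV"
  proof -
    have "\<exists>N. x \<in> A N" for x
    proof -
      obtain B where B: "\<And>n. norm (f n x) \<le> B"
        using ptw[of x] unfolding bounded_iff by auto
      obtain N where "B \<le> real N"
        using real_arch_simple by blast
      then have "x \<in> A N"
        using B unfolding A_def by (auto intro: order_trans)
      then show ?thesis ..
    qed
    then show ?thesis
      by blast
  qed
  have "\<exists>N. interior (A N) \<noteq> {}"
  proof (rule ccontr)
    assume "\<nexists>N. interior (A N) \<noteq> {}"
    then have "(euclidean :: 'a topology) interior_of \<Union>(range A) = {}"
      by (intro Baire_category_alt) (auto simp: completely_metrizable_space_euclidean closed_A)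
    then show False
      by (simp add: cover)
  qed
  then obtain N a r where r: "0 < r" "cball a r \<subseteq> A N"
    by (metis all_not_in_conv mem_interior_cball)
  have "norm (f n) \<le> 2 * real N / r" for n
  proof (rule norm_blinfun_bound)
    show "0 \<le> 2 * real N / r"
      using r by simp
    fix x
    show "norm (f n x) \<le> 2 * real N / r * norm x"
    proof (cases "x = 0")
      case True
      then show ?thesis
        by simp
    next
      case False
      define h where "h = (r / norm x) *\<^sub>R x"
      have "norm h = r"
        unfolding h_def using False r by simp
      then have "a + h \<in> A N" "a \<in> A N"
        using r by (auto simp: subset_eq dist_norm)
      then have "norm (f n (a + h)) \<le> real N" "norm (f n a) \<le> real N"
        unfolding A_def by blast+
      then have "norm (f n (a + h) - f n a) \<le> 2 * real N"
        using norm_triangle_ineq4[of "f n (a + h)" "f n a"] by simp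
      then have "norm (f n h) \<le> 2 * real N"
        by (simp add: blinfun.add_right)
      moreover have "norm (f n h) = r / norm x * norm (f n x)"
        unfolding h_def using r by (simp add: blinfun.scaleR_right)
      ultimately have "r / norm x * norm (f n x) \<le> 2 * real N"
        by simp
      then show ?thesis
        using False r by (simp add: field_simps)
    qed
  qed
  then show ?thesis
    unfolding bounded_iff by auto
qed

lemma limited_range_of_norm_null:
  fixes x :: "nat \<Rightarrow> 'a::banach"
  assumes null: "(\<lambda>k. norm (x k)) \<longlonglongrightarrow> 0"
  shows "limited_set (range x)"
  unfolding limited_set_def
proof (intro allI impI)
  fix f :: "nat \<Rightarrow> 'a \<Rightarrow>\<^sub>L real"
  assume "weak_star_null f"
  then have ptw: "(\<lambda>n. f n y) \<longlonglongrightarrow> 0" for y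
    unfolding weak_star_null_def by blast
  have "bounded (range (\<lambda>n. f n y))" for y
    by (rule convergent_imp_bounded[OF ptw])
  then have "bounded (range f)"
    by (rule banach_steinhaus)
  then obtain C where C: "0 < C" "\<And>n. norm (f n) \<le> C"
    by (auto simp: bounded_pos)
  show "uniform_limit (range x) (\<lambda>n. blinfun_apply (f n)) (\<lambda>_. 0) sequentially"
  proof (rule uniform_limitI)
    fix e :: real
    assume "0 < e"
    then have "\<forall>\<^sub>F k in sequentially. norm (x k) < e / C"
      using null C by (intro order_tendstoD) auto
    then obtain K where K: "\<And>k. K \<le> k \<Longrightarrow> norm (x k) < e / C"
      unfolding eventually_sequentially by blast
    have "\<forall>\<^sub>F n in sequentially. \<forall>k\<in>{..<K}. dist (f n (x k)) 0 < e"
      using ptw \<open>0 < e\<close> by (intro eventually_ball_finite ballI tendstoD) auto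
    then show "\<forall>\<^sub>F n in sequentially. \<forall>y\<in>range x. dist (f n y) 0 < e"
    proof eventually_elim
      case (elim n)
      have "dist (f n (x k)) 0 < e" for k
      proof (cases "k < K")
        case True
        then show ?thesis
          using elim by simp
      next
        case False
        have "norm (f n (x k)) \<le> C * norm (x k)"
          by (rule order_trans[OF norm_blinfun mult_right_mono]) (use C in auto)
        also have "\<dots> < C * (e / C)"
          using K[of k] False C by (intro mult_strict_left_mono) auto
        finally show ?thesis
          using C by simp
      qed
      then show ?case
        by blast
    qed
  qed
qed

section \<open>Hahn-Banach by minimal sublinear functionals\<close>

definition sublinear :: "('a::real_vector \<Rightarrow> real) \<Rightarrow> bool"
  where "sublinear q \<longleftrightarrow>
    (\<forall>x y. q (x + y) \<le> q x + q y) \<and> (\<forall>t x. 0 < t \<longrightarrow> q (t *\<^sub>R x) \<le> t * q x)"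

lemma sublinear_add: "sublinear q \<Longrightarrow> q (x + y) \<le> q x + q y"
  unfolding sublinear_def by blast

lemma sublinear_scaleR:
  assumes "sublinear q" "0 < t"
  shows "q (t *\<^sub>R x) = t * q x"
proof (rule antisym)
  show "q (t *\<^sub>R x) \<le> t * q x"
    using assms unfolding sublinear_def by blast
  have "q (inverse t *\<^sub>R t *\<^sub>R x) \<le> inverse t * q (t *\<^sub>R x)"
    using assms unfolding sublinear_def by (metis inverse_positive_iff_positive)
  then show "t * q x \<le> q (t *\<^sub>R x)"
    using assms by (simp add: field_simps)
qed

lemma sublinear_zero:
  assumes "sublinear q"
  shows "q 0 = 0"
  using sublinear_scaleR[OF assms, of 2 0] by simp

lemma sublinear_minus: "sublinear q \<Longrightarrow> - q (- x) \<le> q x"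
  using sublinear_add[of q x "- x"] sublinear_zero[of q] by simp

text \<open>The estimate for a sum needs a single functional that lies below two given ones, which the
  smaller of the two in the chain is.\<close>

lemma sublinear_cINF:
  fixes Q :: "('a::real_vector \<Rightarrow> real) set"
  assumes ne: "Q \<noteq> {}" and chain: "\<And>q r. q \<in> Q \<Longrightarrow> r \<in> Q \<Longrightarrow> q \<le> r \<or> r \<le> q"
    and sub: "\<And>q. q \<in> Q \<Longrightarrow> sublinear q" and bdd: "\<And>x. bdd_below ((\<lambda>q. q x) ` Q)"
  shows "sublinear (\<lambda>x. INF q\<in>Q. q x)"
  unfolding sublinear_def
proof (intro conjI allI impI)
  fix x y
  have low: "(INF q\<in>Q. q (x + y)) \<le> q x + r y" if qr: "q \<in> Q" "r \<in> Q" for q r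
  proof -
    obtain m where m: "m \<in> Q" "m \<le> q" "m \<le> r"
      using chain[OF qr] qr by blast
    have "(INF q\<in>Q. q (x + y)) \<le> m (x + y)"
      by (rule cINF_lower[OF bdd m(1)])
    also have "\<dots> \<le> m x + m y"
      by (rule sublinear_add[OF sub[OF m(1)]])
    also have "\<dots> \<le> q x + r y"
      using m by (intro add_mono) (auto simp: le_fun_def)
    finally show ?thesis .
  qed
  have "(INF q\<in>Q. q (x + y)) - q x \<le> (INF r\<in>Q. r y)" if "q \<in> Q" for q
    using low[OF that] by (intro cINF_greatest ne) (simp add: diff_le_eq add.commute)
  then have "(INF q\<in>Q. q (x + y)) - (INF r\<in>Q. r y) \<le> (INF q\<in>Q. q x)"
    by (intro cINF_greatest ne) (simp add: algebra_simps)
  then show "(INF q\<in>Q. q (x + y)) \<le> (INF q\<in>Q. q x) + (INF q\<in>Q. q y)"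
    by simp
next
  fix t :: real and x
  assume t: "0 < t"
  have "inverse t * (INF q\<in>Q. q (t *\<^sub>R x)) \<le> (INF q\<in>Q. q x)"
  proof (rule cINF_greatest[OF ne])
    fix q
    assume q: "q \<in> Q"
    have "(INF q\<in>Q. q (t *\<^sub>R x)) \<le> q (t *\<^sub>R x)"
      by (rule cINF_lower[OF bdd q])
    also have "\<dots> = t * q x"
      by (rule sublinear_scaleR[OF sub[OF q] t])
    finally show "inverse t * (INF q\<in>Q. q (t *\<^sub>R x)) \<le> q x"
      using t by (simp add: field_simps)
  qed
  then show "(INF q\<in>Q. q (t *\<^sub>R x)) \<le> t * (INF q\<in>Q. q x)"
    using t by (simp add: field_simps)
qed

text \<open>Lowering \<open>q\<close> along the ray through \<open>z\<close> keeps it sublinear and forces the value at \<open>- z\<close> down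
  to \<open>- q z\<close>. A minimal sublinear functional therefore satisfies \<open>q (- z) = - q z\<close> for every \<open>z\<close>.\<close>

lemma sublinear_lower_along_ray:
  fixes q :: "'a::real_vector \<Rightarrow> real"
  assumes q: "sublinear q"
  obtains r where "sublinear r" "r \<le> q" "r (- z) \<le> - q z"
proof -
  define r where "r x = (INF t\<in>{0..}. q (x + t *\<^sub>R z) - t * q z)" for x
  have scale: "q (t *\<^sub>R z) = t * q z" if "0 \<le> t" for t
    using sublinear_scaleR[OF q, of t z] sublinear_zero[OF q] that by (cases "t = 0") auto
  have "- q (- x) \<le> q (x + t *\<^sub>R z) - t * q z" if "0 \<le> t" for x t
    using sublinear_add[OF q, of "x + t *\<^sub>R z" "- x"] scale[OF that] by simp
  then have bdd: "bdd_below ((\<lambda>t. q (x + t *\<^sub>R z) - t * q z) ` {0..})" for x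
    by (auto intro!: bdd_belowI[where m = "- q (- x)"])
  have lower: "r x \<le> q (x + t *\<^sub>R z) - t * q z" if "0 \<le> t" for x t
    unfolding r_def using that by (intro cINF_lower bdd) simp
  have greatest: "c \<le> r x" if "\<And>t. 0 \<le> t \<Longrightarrow> c \<le> q (x + t *\<^sub>R z) - t * q z" for c x
    unfolding r_def using that by (intro cINF_greatest) auto
  have "sublinear r"
    unfolding sublinear_def
  proof (intro conjI allI impI)
    fix x y
    have low: "r (x + y) \<le> (q (x + s *\<^sub>R z) - s * q z) + (q (y + t *\<^sub>R z) - t * q z)"
      if "0 \<le> s" "0 \<le> t" for s t
    proof -
      have "r (x + y) \<le> q (x + y + (s + t) *\<^sub>R z) - (s + t) * q z"
        using that by (intro lower) simp
      also have "x + y + (s + t) *\<^sub>R z = (x + s *\<^sub>R z) + (y + t *\<^sub>R z)"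
        by (simp add: algebra_simps)
      also have "q \<dots> \<le> q (x + s *\<^sub>R z) + q (y + t *\<^sub>R z)"
        by (rule sublinear_add[OF q])
      finally show ?thesis
        by (simp add: algebra_simps)
    qed
    have "r (x + y) - (q (x + s *\<^sub>R z) - s * q z) \<le> r y" if "0 \<le> s" for s
      using low[OF that] by (intro greatest) (simp add: algebra_simps)
    then have "r (x + y) - r y \<le> r x"
      by (intro greatest) (simp add: algebra_simps)
    then show "r (x + y) \<le> r x + r y"
      by simp
  next
    fix a :: real and x
    assume a: "0 < a"
    have "inverse a * r (a *\<^sub>R x) \<le> r x"
    proof (rule greatest)
      fix t :: real
      assume "0 \<le> t"
      then have "r (a *\<^sub>R x) \<le> q (a *\<^sub>R x + (a * t) *\<^sub>R z) - (a * t) * q z"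
        using a by (intro lower) simp
      also have "q (a *\<^sub>R x + (a * t) *\<^sub>R z) = a * q (x + t *\<^sub>R z)"
        using sublinear_scaleR[OF q a, of "x + t *\<^sub>R z"] by (simp add: scaleR_add_right)
      finally show "inverse a * r (a *\<^sub>R x) \<le> q (x + t *\<^sub>R z) - t * q z"
        using a by (simp add: field_simps)
    qed
    then show "r (a *\<^sub>R x) \<le> a * r x"
      using a by (simp add: field_simps)
  qed
  moreover have "r \<le> q"
    unfolding le_fun_def using lower[of 0] by simp
  moreover have "r (- z) \<le> - q z"
    using lower[of 1 "- z"] sublinear_zero[OF q] by simp
  ultimately show thesis
    by (rule that)
qed

text \<open>Zorn's lemma applies because \<open>- p (- x)\<close> bounds the values at \<open>x\<close> of all sublinear functionals
  below \<open>p\<close>, which makes the pointwise infimum of a chain finite.\<close>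

lemma minimal_sublinear_exists:
  fixes p :: "'a::real_vector \<Rightarrow> real"
  assumes p: "sublinear p"
  obtains q where "sublinear q" "q \<le> p" "\<And>r. sublinear r \<Longrightarrow> r \<le> q \<Longrightarrow> r = q"
proof -
  define A where "A = {q. sublinear q \<and> q \<le> p}"
  have "\<exists>m\<in>A. \<forall>a\<in>A. m \<ge> a \<longrightarrow> a = m"
  proof (rule predicate_Zorn)
    show "partial_order_on A (relation_of (\<ge>) A)"
      by (rule partial_order_on_relation_ofI) auto
  next
    fix C
    assume C: "C \<in> Chains (relation_of (\<ge>) A)"
    then have CA: "C \<subseteq> A" and chain: "\<And>q r. q \<in> C \<Longrightarrow> r \<in> C \<Longrightarrow> q \<le> r \<or> r \<le> q"
      unfolding Chains_def relation_of_def by blast+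
    show "\<exists>u\<in>A. \<forall>a\<in>C. a \<ge> u"
    proof (cases "C = {}")
      case True
      then show ?thesis
        using p unfolding A_def by auto
    next
      case False
      have sub: "sublinear q" "q \<le> p" if "q \<in> C" for q
        using CA that unfolding A_def by auto
      have bdd: "bdd_below ((\<lambda>q. q x) ` C)" for x
      proof (rule bdd_belowI2)
        fix q
        assume q: "q \<in> C"
        have "q (- x) \<le> p (- x)"
          using sub(2)[OF q] by (rule le_funD)
        then show "- p (- x) \<le> q x"
          using sublinear_minus[OF sub(1)[OF q], of x] by simp
      qed
      define u where "u x = (INF q\<in>C. q x)" for x
      have u_le: "u \<le> q" if "q \<in> C" for q
        unfolding u_def le_fun_def using that by (auto intro: cINF_lower[OF bdd])
      moreover have "sublinear u"
        unfolding u_def by (rule sublinear_cINF[OF False chain sub(1) bdd])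
      moreover obtain q where "q \<in> C"
        using False by blast
      ultimately have "u \<in> A"
        unfolding A_def using sub(2) order_trans by blast
      then show ?thesis
        using u_le by blast
    qed
  qed
  then obtain q where "q \<in> A" and min: "\<And>r. r \<in> A \<Longrightarrow> r \<le> q \<Longrightarrow> r = q"
    by blast
  then show thesis
    using that[of q] unfolding A_def by (metis (mono_tags, lifting) mem_Collect_eq order_trans)
qed

text \<open>A minimal sublinear functional is odd, hence linear. Minimizing only after a first lowering along
  the ray through \<open>z\<close> pins the value at \<open>- z\<close> to at most \<open>- p z\<close>, so \<open>p z\<close> is attained.\<close>

lemma hahn_banach_attaining:
  fixes p :: "'a::real_vector \<Rightarrow> real"
  assumes p: "sublinear p"
  obtains f where "linear f" "\<And>x. f x \<le> p x" "f z = p z"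
proof -
  obtain p' where p': "sublinear p'" "p' \<le> p" "p' (- z) \<le> - p z"
    using sublinear_lower_along_ray[OF p] by blast
  obtain q where q: "sublinear q" "q \<le> p'" and min: "\<And>r. sublinear r \<Longrightarrow> r \<le> q \<Longrightarrow> r = q"
    using minimal_sublinear_exists[OF p'(1)] by blast
  have neg: "q (- x) = - q x" for x
  proof (rule antisym)
    obtain r where "sublinear r" "r \<le> q" "r (- x) \<le> - q x"
      using sublinear_lower_along_ray[OF q(1)] by blast
    then show "q (- x) \<le> - q x"
      using min by metis
    show "- q x \<le> q (- x)"
      using sublinear_minus[OF q(1), of "- x"] by simp
  qed
  have add: "q (x + y) = q x + q y" for x y
  proof (rule antisym)
    show "q (x + y) \<le> q x + q y"
      by (rule sublinear_add[OF q(1)])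
    have "q ((x + y) + - y) \<le> q (x + y) + q (- y)"
      by (rule sublinear_add[OF q(1)])
    then show "q x + q y \<le> q (x + y)"
      by (simp add: neg)
  qed
  have scale: "q (t *\<^sub>R x) = t *\<^sub>R q x" for t x
  proof -
    consider "t < 0" | "t = 0" | "0 < t"
      by linarith
    then show ?thesis
    proof cases
      case 1
      then have "q (- t *\<^sub>R x) = - t * q x"
        by (intro sublinear_scaleR[OF q(1)]) simp
      then show ?thesis
        using neg[of "t *\<^sub>R x"] by simp
    qed (use sublinear_zero[OF q(1)] sublinear_scaleR[OF q(1)] in auto)
  qed
  have "q z = p z"
  proof (rule antisym)
    show "q z \<le> p z"
      using q(2) p'(2) by (meson le_funD order_trans)
    have "q (- z) \<le> - p z"
      using q(2) p'(3) by (meson le_funD order_trans)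
    then show "p z \<le> q z"
      by (simp add: neg)
  qed
  moreover have "q x \<le> p x" for x
    using q(2) p'(2) by (meson le_funD order_trans)
  moreover have "linear q"
    by (rule linearI) (rule add, rule scale)
  ultimately show thesis
    by (intro that)
qed

section \<open>Weak* null sequences of norming functionals\<close>

text \<open>Under order continuity this is the norm of the component of \<open>\<bar>x\<bar>\<close> in the band generated by
  \<open>a\<close>. Working with the seminorm makes it unnecessary to construct the band projection.\<close>

definition band_seminorm :: "'a::banach_lattice \<Rightarrow> 'a \<Rightarrow> real"
  where "band_seminorm a x = (SUP m::nat. norm (inf \<bar>x\<bar> (real m *\<^sub>R a)))"

lemma norm_inf_abs_le:
  fixes x b :: "'a::banach_lattice"
  assumes "0 \<le> b"
  shows "norm (inf \<bar>x\<bar> b) \<le> norm x"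
proof -
  have "norm (inf \<bar>x\<bar> b) \<le> norm \<bar>x\<bar>"
    using assms by (intro norm_mono_nonneg) auto
  then show ?thesis
    by (simp add: norm_abs_lattice)
qed

context
  fixes a :: "'a::banach_lattice"
  assumes a: "0 \<le> a"
begin

lemma band_seminorm_bdd: "bdd_above (range (\<lambda>m::nat. norm (inf \<bar>x\<bar> (real m *\<^sub>R a))))"
  using a by (intro bdd_aboveI2[where M = "norm x"] norm_inf_abs_le) (simp add: scaleR_nonneg_nonneg)

lemma band_seminorm_upper: "norm (inf \<bar>x\<bar> (real m *\<^sub>R a)) \<le> band_seminorm a x"
  unfolding band_seminorm_def by (intro cSUP_upper band_seminorm_bdd) simp

lemma band_seminorm_le_norm: "band_seminorm a x \<le> norm x"
  unfolding band_seminorm_def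
  using a by (intro cSUP_least norm_inf_abs_le) (simp_all add: scaleR_nonneg_nonneg)

lemma sublinear_band_seminorm: "sublinear (band_seminorm a)"
  unfolding sublinear_def
proof (intro conjI allI impI)
  fix x y
  show "band_seminorm a (x + y) \<le> band_seminorm a x + band_seminorm a y"
    unfolding band_seminorm_def[of a "x + y"]
  proof (rule cSUP_least)
    fix m :: nat
    have ma: "0 \<le> real m *\<^sub>R a"
      using a by (simp add: scaleR_nonneg_nonneg)
    have "inf \<bar>x + y\<bar> (real m *\<^sub>R a) \<le> inf (\<bar>x\<bar> + \<bar>y\<bar>) (real m *\<^sub>R a)"
      by (intro inf_mono abs_triangle_ineq order_refl)
    also have "\<dots> \<le> inf \<bar>x\<bar> (real m *\<^sub>R a) + inf \<bar>y\<bar> (real m *\<^sub>R a)"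
      by (intro inf_add_le ma abs_ge_zero)
    finally have "norm (inf \<bar>x + y\<bar> (real m *\<^sub>R a))
        \<le> norm (inf \<bar>x\<bar> (real m *\<^sub>R a) + inf \<bar>y\<bar> (real m *\<^sub>R a))"
      by (intro norm_mono_nonneg) (simp_all add: ma)
    also have "\<dots> \<le> norm (inf \<bar>x\<bar> (real m *\<^sub>R a)) + norm (inf \<bar>y\<bar> (real m *\<^sub>R a))"
      by (rule norm_triangle_ineq)
    also have "\<dots> \<le> band_seminorm a x + band_seminorm a y"
      by (intro add_mono band_seminorm_upper)
    finally show "norm (inf \<bar>x + y\<bar> (real m *\<^sub>R a)) \<le> band_seminorm a x + band_seminorm a y" .
  qed simp
next
  fix t :: real and x
  assume t: "0 < t"
  show "band_seminorm a (t *\<^sub>R x) \<le> t * band_seminorm a x"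
    unfolding band_seminorm_def[of a "t *\<^sub>R x"]
  proof (rule cSUP_least)
    fix m :: nat
    let ?z = "inf \<bar>t *\<^sub>R x\<bar> (real m *\<^sub>R a)"
    obtain n :: nat where n: "inverse t * real m \<le> real n"
      using real_arch_simple by blast
    have z: "0 \<le> ?z"
      using a by (simp add: scaleR_nonneg_nonneg)
    have "inverse t *\<^sub>R ?z \<le> \<bar>x\<bar>"
    proof -
      have "t *\<^sub>R x \<le> t *\<^sub>R \<bar>x\<bar>" "t *\<^sub>R (- x) \<le> t *\<^sub>R \<bar>x\<bar>"
        using t by (intro scaleR_left_mono abs_ge_self abs_ge_minus_self; simp)+
      then have "?z \<le> t *\<^sub>R \<bar>x\<bar>"
        by (intro le_infI1 abs_leI) simp_all
      then have "inverse t *\<^sub>R ?z \<le> inverse t *\<^sub>R t *\<^sub>R \<bar>x\<bar>"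
        using t by (intro scaleR_left_mono) simp_all
      then show ?thesis
        using t by simp
    qed
    moreover have "inverse t *\<^sub>R ?z \<le> real n *\<^sub>R a"
    proof -
      have "inverse t *\<^sub>R ?z \<le> inverse t *\<^sub>R real m *\<^sub>R a"
        using t by (intro scaleR_left_mono) simp_all
      also have "\<dots> \<le> real n *\<^sub>R a"
        using scaleR_right_mono[OF n a] by simp
      finally show ?thesis .
    qed
    ultimately have "norm (inverse t *\<^sub>R ?z) \<le> norm (inf \<bar>x\<bar> (real n *\<^sub>R a))"
      using t z by (intro norm_mono_nonneg) (simp_all add: scaleR_nonneg_nonneg)
    also have "\<dots> \<le> band_seminorm a x"
      by (rule band_seminorm_upper)
    finally show "norm ?z \<le> t * band_seminorm a x"
      using t by (simp add: field_simps)
  qed simp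
qed

end

lemma band_seminorm_abs_self: "band_seminorm \<bar>x\<bar> x = norm x"
proof (rule antisym)
  show "band_seminorm \<bar>x\<bar> x \<le> norm x"
    by (intro band_seminorm_le_norm) simp
  show "norm x \<le> band_seminorm \<bar>x\<bar> x"
    using band_seminorm_upper[of "\<bar>x\<bar>" x 1] by (simp add: norm_abs_lattice)
qed

lemma norming_functional_in_band:
  fixes z :: "'a::banach_lattice"
  obtains f :: "'a \<Rightarrow>\<^sub>L real" where "\<And>x. \<bar>f x\<bar> \<le> band_seminorm \<bar>z\<bar> x" "f z = norm z"
proof -
  let ?p = "band_seminorm \<bar>z\<bar>"
  obtain f where f: "linear f" "\<And>x. f x \<le> ?p x" "f z = ?p z"
    using hahn_banach_attaining[OF sublinear_band_seminorm[of "\<bar>z\<bar>"]] by auto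
  have abs_le: "\<bar>f x\<bar> \<le> ?p x" for x
  proof -
    have "?p (- x) = ?p x"
      unfolding band_seminorm_def by simp
    then have "- f x \<le> ?p x"
      using f(2)[of "- x"] linear_neg[OF f(1), of x] by simp
    then show ?thesis
      using f(2)[of x] by simp
  qed
  have "norm (f x) \<le> norm x * 1" for x
    using abs_le[of x] band_seminorm_le_norm[of "\<bar>z\<bar>" x] by simp
  then have "bounded_linear f"
    using f(1) by (intro bounded_linear.intro bounded_linear_axioms.intro) blast+
  then have "blinfun_apply (Blinfun f) = f"
    by (rule bounded_linear_Blinfun_apply)
  then show thesis
    using that[of "Blinfun f"] abs_le f(3) by (simp add: band_seminorm_abs_self)
qed

lemma inf_scaleR_disjoint:
  fixes a b :: "'a::banach_lattice"
  assumes "0 \<le> a" "0 \<le> b" "inf a b = 0" "0 \<le> s" "0 \<le> t"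
  shows "inf (s *\<^sub>R a) (t *\<^sub>R b) = 0"
proof (rule antisym)
  define r where "r = max (max s t) 1"
  have r: "s \<le> r" "t \<le> r" "0 < r"
    unfolding r_def by auto
  let ?z = "inf (s *\<^sub>R a) (t *\<^sub>R b)"
  have "?z \<le> r *\<^sub>R a" "?z \<le> r *\<^sub>R b"
    using r assms by (auto intro: le_infI1 le_infI2 scaleR_right_mono)
  then have "inverse r *\<^sub>R ?z \<le> inverse r *\<^sub>R r *\<^sub>R a" "inverse r *\<^sub>R ?z \<le> inverse r *\<^sub>R r *\<^sub>R b"
    using r by (intro scaleR_left_mono; simp)+
  then have "inverse r *\<^sub>R ?z \<le> inf a b"
    using r by simp
  then have "r *\<^sub>R inverse r *\<^sub>R ?z \<le> r *\<^sub>R 0"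
    using r assms by (intro scaleR_left_mono) simp_all
  then show "?z \<le> 0"
    using r by simp
  show "0 \<le> ?z"
    using assms by (simp add: scaleR_nonneg_nonneg)
qed

text \<open>The functional chosen for \<open>x n\<close> lives on the band generated by \<open>x n\<close>, so at a fixed \<open>y\<close> it is
  controlled by a truncation of \<open>\<bar>y\<bar>\<close> in that band. These truncations are disjoint and lie below
  \<open>\<bar>y\<bar>\<close>, hence tend to zero in norm.\<close>

lemma disjoint_norming_functionals_weak_star_null:
  fixes x :: "nat \<Rightarrow> 'a::banach_lattice"
  assumes oc: "order_continuous_norm TYPE('a)" and disj: "disjoint_seq x"
  obtains f where "weak_star_null f" "\<And>n. blinfun_apply (f n) (x n) = norm (x n)"
proof -
  have "\<exists>f :: 'a \<Rightarrow>\<^sub>L real. (\<forall>y. \<bar>f y\<bar> \<le> band_seminorm \<bar>x n\<bar> y) \<and> f (x n) = norm (x n)" for n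
    using norming_functional_in_band[of "x n"] by metis
  then obtain f :: "nat \<Rightarrow> 'a \<Rightarrow>\<^sub>L real"
    where f: "\<And>n y. \<bar>f n y\<bar> \<le> band_seminorm \<bar>x n\<bar> y" "\<And>n. f n (x n) = norm (x n)"
    by metis
  have "(\<lambda>n. f n y) \<longlonglongrightarrow> 0" for y
  proof -
    \<comment> \<open>Truncation at a finite multiple of \<open>\<bar>x n\<bar>\<close> attains the seminorm up to an error tending to zero.\<close>
    have "\<exists>m::nat. band_seminorm \<bar>x n\<bar> y < norm (inf \<bar>y\<bar> (real m *\<^sub>R \<bar>x n\<bar>)) + inverse (real (Suc n))" for n
    proof -
      have "band_seminorm \<bar>x n\<bar> y - inverse (real (Suc n)) < (SUP m::nat. norm (inf \<bar>y\<bar> (real m *\<^sub>R \<bar>x n\<bar>)))"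
        by (simp add: band_seminorm_def)
      then obtain m :: nat where
        "band_seminorm \<bar>x n\<bar> y - inverse (real (Suc n)) < norm (inf \<bar>y\<bar> (real m *\<^sub>R \<bar>x n\<bar>))"
        using less_cSUP_iff[OF _ band_seminorm_bdd[of "\<bar>x n\<bar>" y]] by auto
      then show ?thesis
        by (auto simp: diff_less_eq)
    qed
    then obtain m :: "nat \<Rightarrow> nat" where
      m: "\<And>n. band_seminorm \<bar>x n\<bar> y < norm (inf \<bar>y\<bar> (real (m n) *\<^sub>R \<bar>x n\<bar>)) + inverse (real (Suc n))"
      by metis
    define d where "d n = inf \<bar>y\<bar> (real (m n) *\<^sub>R \<bar>x n\<bar>)" for n
    have d_nonneg: "0 \<le> d n" for n
      unfolding d_def by (simp add: scaleR_nonneg_nonneg)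
    have "inf (d n) (d k) = 0" if "n \<noteq> k" for k n
    proof (rule antisym)
      have "inf (d n) (d k) \<le> inf (real (m n) *\<^sub>R \<bar>x n\<bar>) (real (m k) *\<^sub>R \<bar>x k\<bar>)"
        unfolding d_def by (intro inf_mono) simp_all
      also have "\<dots> = 0"
        using disj that unfolding disjoint_seq_def by (intro inf_scaleR_disjoint) auto
      finally show "inf (d n) (d k) \<le> 0" .
    qed (simp add: d_nonneg)
    then have "(\<lambda>n. norm (d n)) \<longlonglongrightarrow> 0"
      by (intro order_continuous_norm_disjoint_null[OF oc d_nonneg, where x = "\<bar>y\<bar>"]) (simp_all add: d_def)
    then have "(\<lambda>n. norm (d n) + inverse (real (Suc n))) \<longlonglongrightarrow> 0 + 0"
      by (intro tendsto_add LIMSEQ_inverse_real_of_nat)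
    then have bound_null: "(\<lambda>n. norm (d n) + inverse (real (Suc n))) \<longlonglongrightarrow> 0"
      by simp
    have "norm (f n y) \<le> norm (d n) + inverse (real (Suc n))" for n
      using f(1)[where n = n and y = y] m[of n] unfolding d_def by simp
    then show ?thesis
      by (intro Lim_null_comparison[OF _ bound_null] always_eventually allI)
  qed
  then show thesis
    using that[of f] f(2) unfolding weak_star_null_def by blast
qed

section \<open>Extracting a disjoint sequence from a bounded positive series\<close>

text \<open>The nontrivial half of the distributivity of the lattice of a lattice ordered group, here for
  \<open>sup _ 0\<close> over a binary infimum. The inequality becomes linear once \<open>inf (inf a b) 0\<close>
  is added to both sides.\<close>

lemma inf_pprt_le: "inf (pprt a) (pprt b) \<le> pprt (inf a (b::'a::lattice_ab_group_add))"
proof -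
  let ?t = "inf (pprt a) (pprt b)" and ?n = "inf (inf a b) 0"
  have "pprt a = a - inf a 0" "pprt b = b - inf b 0"
    using add_eq_inf_sup[of a 0] add_eq_inf_sup[of b 0] unfolding pprt_def
    by (simp_all only: eq_diff_eq add_0_right)
  then have "?t + inf a 0 \<le> a" "?t + inf b 0 \<le> b"
    by (metis inf_le1 le_diff_eq, metis inf_le2 le_diff_eq)
  moreover have "?n \<le> inf a 0" "?n \<le> inf b 0"
    by (auto intro: le_infI1)
  ultimately have "?t + ?n \<le> inf a b"
    by (metis add_left_mono inf_greatest order_trans)
  moreover have "pprt (inf a b) = inf a b - ?n"
    using add_eq_inf_sup[of "inf a b" 0] unfolding pprt_def by (simp only: eq_diff_eq add_0_right)
  ultimately show ?thesis
    by (simp only: le_diff_eq)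
qed

text \<open>For nonempty \<open>S\<close> the infimum of the \<open>a i\<close> is a witness; for empty \<open>S\<close>, where it does not exist,
  \<open>u\<close> itself is.\<close>

lemma le_pprt_common_lower_bound:
  fixes u :: "'a::lattice_ab_group_add"
  assumes "finite S" "0 \<le> u" "\<And>i. i \<in> S \<Longrightarrow> u \<le> pprt (a i)"
  shows "\<exists>c. (\<forall>i\<in>S. c \<le> a i) \<and> u \<le> pprt c"
  using assms(1,3)
proof (induction S)
  case empty
  then show ?case
    using assms(2) by (intro exI[of _ u]) simp
next
  case (insert i S)
  then obtain c where c: "\<forall>i\<in>S. c \<le> a i" "u \<le> pprt c"
    by auto
  have "u \<le> inf (pprt c) (pprt (a i))"
    using c insert.prems by simp
  then have "u \<le> pprt (inf c (a i))"
    using inf_pprt_le order_trans by blast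
  then show ?case
    using c by (intro exI[of _ "inf c (a i)"]) (auto intro: le_infI1)
qed

text \<open>Fewer than \<open>1 / \<epsilon>\<close> of the excesses of terms of the series over \<open>\<epsilon> x\<close> can have
  a nonzero common part, since the terms add up to at most \<open>x\<close>.\<close>

lemma common_part_of_excesses_zero:
  fixes y :: "nat \<Rightarrow> 'a::banach_lattice"
  assumes sums: "\<And>S. finite S \<Longrightarrow> (\<Sum>i\<in>S. y i) \<le> x" and "0 \<le> x"
    and S: "finite S" "0 < card S" "1 \<le> real (card S) * \<epsilon>"
    and u: "0 \<le> u" "\<And>i. i \<in> S \<Longrightarrow> u \<le> pprt (y i - \<epsilon> *\<^sub>R x)"
  shows "u = 0"
proof -
  \<comment> \<open>Adding up the bounds on \<open>c\<close> shows that it is at most zero.\<close>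
  obtain c where c: "\<forall>i\<in>S. c \<le> y i - \<epsilon> *\<^sub>R x" "u \<le> pprt c"
    using le_pprt_common_lower_bound[where a = "\<lambda>i. y i - \<epsilon> *\<^sub>R x", OF S(1) u] by blast
  have "real (card S) *\<^sub>R c = (\<Sum>i\<in>S. c)"
    by (simp add: sum_constant_scaleR)
  also have "\<dots> \<le> (\<Sum>i\<in>S. y i - \<epsilon> *\<^sub>R x)"
    using c by (intro sum_mono) blast
  also have "\<dots> = (\<Sum>i\<in>S. y i) - (real (card S) * \<epsilon>) *\<^sub>R x"
    by (simp add: sum_subtractf sum_constant_scaleR)
  also have "\<dots> \<le> x - 1 *\<^sub>R x"
    by (intro diff_mono sums S(1) scaleR_right_mono S(3) \<open>0 \<le> x\<close>)
  finally have "inverse (real (card S)) *\<^sub>R real (card S) *\<^sub>R c \<le> inverse (real (card S)) *\<^sub>R 0"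
    by (intro scaleR_left_mono) simp_all
  then have "c \<le> 0"
    using S(2) by simp
  then have "pprt c = 0"
    by simp
  then show ?thesis
    using u(1) c(2) by (simp add: order_antisym)
qed

lemma not_norm_null_frequently:
  fixes w :: "nat \<Rightarrow> 'a::real_normed_vector"
  assumes "\<not> (\<lambda>n. norm (w n)) \<longlonglongrightarrow> 0"
  shows "\<exists>\<delta>>0. \<forall>N. \<exists>n\<ge>N. \<delta> \<le> norm (w n)"
  using assms unfolding LIMSEQ_iff by (auto simp: not_less)

text \<open>Each of these terms, with finitely many exceptions, becomes disjoint from the later ones in the
  limit, so there is a subsequence \<open>g\<close> with overlaps \<open>inf (g k) (g j)\<close> small enough to form a convergent
  series for each \<open>k\<close>. Subtracting from \<open>g k\<close> its overlaps with all other terms and taking positive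
  parts makes the sequence disjoint and costs at most half of the lower bound \<open>\<delta>\<close> on the norms.\<close>

lemma disjoint_sequence_of_asymptotically_disjoint:
  fixes w :: "nat \<Rightarrow> 'a::banach_lattice"
  assumes nonneg: "\<And>n. 0 \<le> w n" and not_null: "\<not> (\<lambda>n. norm (w n)) \<longlonglongrightarrow> 0"
    and "finite S" and asym: "\<And>m. m \<notin> S \<Longrightarrow> (\<lambda>n. norm (inf (w m) (w n))) \<longlonglongrightarrow> 0"
  obtains z h where "\<And>k::nat. 0 \<le> z k" "\<And>k. z k \<le> w (h k)" "\<And>j k. j \<noteq> k \<Longrightarrow> inf (z j) (z k) = 0"
    "\<not> (\<lambda>k. norm (z k)) \<longlonglongrightarrow> 0"
proof -
  obtain \<delta> where \<delta>: "0 < \<delta>" "\<And>N. \<exists>n\<ge>N. \<delta> \<le> norm (w n)"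
    using not_norm_null_frequently[OF not_null] by blast
  \<comment> \<open>A new term is compared with all earlier indices outside \<open>S\<close> and not just the selected ones, so that
    each choice depends only on the preceding one.\<close>
  have "\<exists>h. \<forall>k. (h k \<notin> S \<and> \<delta> \<le> norm (w (h k))) \<and>
    (h k < h (Suc k) \<and> (\<forall>m\<in>{..h k} - S. norm (inf (w m) (w (h (Suc k)))) < \<delta>/4 * (1/2)^Suc k))"
  proof (rule dependent_nat_choice)
    have "\<forall>\<^sub>F n in sequentially. n \<notin> S"
      using \<open>finite S\<close> eventually_cofinite[of "\<lambda>n. n \<notin> S"] by (simp add: cofinite_eq_sequentially)
    then obtain N where "\<And>n. N \<le> n \<Longrightarrow> n \<notin> S"
      unfolding eventually_sequentially by blast
    then show "\<exists>n. n \<notin> S \<and> \<delta> \<le> norm (w n)"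
      using \<delta>(2)[of N] by blast
  next
    fix l k :: nat
    have "\<forall>\<^sub>F n in sequentially. n \<notin> S"
      using \<open>finite S\<close> eventually_cofinite[of "\<lambda>n. n \<notin> S"] by (simp add: cofinite_eq_sequentially)
    moreover have "\<forall>\<^sub>F n in sequentially. l < n"
      by (rule eventually_gt_at_top)
    moreover have "\<forall>\<^sub>F n in sequentially. \<forall>m\<in>{..l} - S. norm (inf (w m) (w n)) < \<delta>/4 * (1/2)^Suc k"
      using \<delta>(1) asym by (intro eventually_ball_finite ballI order_tendstoD(2)[where y = 0]) auto
    ultimately have "\<forall>\<^sub>F n in sequentially. n \<notin> S \<and> l < n \<and>
        (\<forall>m\<in>{..l} - S. norm (inf (w m) (w n)) < \<delta>/4 * (1/2)^Suc k)"
      by eventually_elim blast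
    then obtain N where N: "\<And>n. N \<le> n \<Longrightarrow> n \<notin> S \<and> l < n \<and>
        (\<forall>m\<in>{..l} - S. norm (inf (w m) (w n)) < \<delta>/4 * (1/2)^Suc k)"
      unfolding eventually_sequentially by blast
    obtain n where "N \<le> n" "\<delta> \<le> norm (w n)"
      using \<delta>(2) by blast
    then show "\<exists>n. (n \<notin> S \<and> \<delta> \<le> norm (w n)) \<and>
        (l < n \<and> (\<forall>m\<in>{..l} - S. norm (inf (w m) (w n)) < \<delta>/4 * (1/2)^Suc k))"
      using N by blast
  qed
  then obtain h where h: "\<And>k. h k \<notin> S" "\<And>k. \<delta> \<le> norm (w (h k))" "\<And>k. h k < h (Suc k)"
    and h_small: "\<And>k m. m \<le> h k \<Longrightarrow> m \<notin> S \<Longrightarrow> norm (inf (w m) (w (h (Suc k)))) < \<delta>/4 * (1/2)^Suc k"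
    by (metis DiffI atMost_iff)
  define g where "g k = w (h k)" for k
  have "strict_mono h"
    using h(3) by (rule strict_mono_Suc_iff[THEN iffD2, rule_format])
  have g_nonneg: "0 \<le> g k" for k
    unfolding g_def by (rule nonneg)
  have small: "norm (inf (g j) (g k)) \<le> \<delta>/4 * (1/2)^k" if jk: "j < k" for j k
  proof -
    obtain i where i: "k = Suc i"
      using jk by (cases k) auto
    then have "h j \<le> h i"
      using jk \<open>strict_mono h\<close> by (simp add: strict_mono_less_eq)
    then show ?thesis
      using h_small[OF _ h(1)] unfolding g_def i by (meson less_imp_le)
  qed
  \<comment> \<open>The diagonal is zero, so the overlaps can be summed over all indices. Their norms are bounded by the
    terms of a geometric series with sum \<open>\<delta> / 2\<close>.\<close>
  define ov where "ov k j = (if j = k then 0 else inf (g k) (g j))" for k j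
  have ov_nonneg: "0 \<le> ov k j" for k j
    unfolding ov_def using g_nonneg by simp
  have ov_small: "norm (ov k j) \<le> \<delta>/4 * (1/2)^j" for k j
  proof -
    consider "j = k" | "k < j" | "j < k"
      by linarith
    then show ?thesis
    proof cases
      case 1
      then show ?thesis
        using \<delta>(1) by (simp add: ov_def)
    next
      case 2
      then show ?thesis
        using small[of k j] by (simp add: ov_def)
    next
      case 3
      then have "norm (ov k j) \<le> \<delta>/4 * (1/2)^k"
        using small[of j k] by (simp add: ov_def inf_commute)
      also have "\<dots> \<le> \<delta>/4 * (1/2)^j"
        using 3 \<delta>(1) by (intro mult_left_mono power_decreasing) auto
      finally show ?thesis .
    qed
  qed
  have geo: "(\<lambda>j. \<delta>/4 * (1/2)^j) sums (\<delta>/2)"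
    using sums_mult[OF geometric_sums[of "1/2::real"], of "\<delta>/4"] by simp
  have summable_ov: "summable (ov k)" for k
    by (rule summable_comparison_test'[OF sums_summable[OF geo], where N = 0]) (rule ov_small)
  define s where "s k = (\<Sum>j. ov k j)" for k
  have norm_s: "norm (s k) \<le> \<delta>/2" for k
  proof -
    have "summable (\<lambda>j. norm (ov k j))"
      by (rule summable_comparison_test'[OF sums_summable[OF geo], where N = 0]) (use ov_small in simp)
    then have "norm (s k) \<le> (\<Sum>j. norm (ov k j))" "(\<Sum>j. norm (ov k j)) \<le> (\<Sum>j. \<delta>/4 * (1/2)^j)"
      unfolding s_def using ov_small sums_summable[OF geo]
      by (auto intro!: summable_norm suminf_le)
    then show ?thesis
      using sums_unique[OF geo] by simp
  qed
  have ov_le: "ov k j \<le> s k" for k j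
  proof (rule banach_lattice_lim_le)
    show "(\<lambda>n. ov k j) \<longlonglongrightarrow> ov k j"
      by simp
    show "(\<lambda>n. \<Sum>i<n + Suc j. ov k i) \<longlonglongrightarrow> s k"
      unfolding s_def by (intro LIMSEQ_ignore_initial_segment summable_LIMSEQ summable_ov)
    show "ov k j \<le> (\<Sum>i<n + Suc j. ov k i)" for n
      using sum_mono2[of "{..<n + Suc j}" "{j}" "ov k"] ov_nonneg by simp
  qed
  have s_nonneg: "0 \<le> s k" for k
    using ov_nonneg ov_le order_trans by blast
  define z where "z k = pprt (g k - s k)" for k
  have "z k \<le> w (h k)" for k
  proof -
    have "z k \<le> pprt (g k)"
      unfolding z_def using s_nonneg by (intro pprt_mono) simp
    then show ?thesis
      using g_nonneg[of k] by (simp add: g_def)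
  qed
  moreover have "inf (z j) (z k) = 0" if jk: "j \<noteq> k" for j k
  proof (rule antisym)
    let ?o = "inf (g j) (g k)"
    have "?o \<le> s j" "?o \<le> s k"
      using jk ov_le[of j k] ov_le[of k j] by (auto simp: ov_def inf_commute)
    then have "inf (z j) (z k) \<le> inf (pprt (g j - ?o)) (pprt (g k - ?o))"
      unfolding z_def by (intro inf_mono pprt_mono diff_left_mono)
    also have "\<dots> \<le> pprt (inf (g j - ?o) (g k - ?o))"
      by (rule inf_pprt_le)
    also have "inf (g j - ?o) (g k - ?o) = 0"
      by (metis add_inf_distrib_right diff_conv_add_uminus right_minus)
    finally show "inf (z j) (z k) \<le> 0"
      by simp
  qed (simp add: z_def)
  moreover have "\<not> (\<lambda>k. norm (z k)) \<longlonglongrightarrow> 0"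
  proof
    assume "(\<lambda>k. norm (z k)) \<longlonglongrightarrow> 0"
    then have "\<forall>\<^sub>F k in sequentially. norm (z k) < \<delta>/2"
      using \<delta>(1) by (intro order_tendstoD) auto
    then obtain k where k: "norm (z k) < \<delta>/2"
      unfolding eventually_sequentially by blast
    have "g k - s k \<le> z k"
      unfolding z_def pprt_def by simp
    then have "norm (g k) \<le> norm (z k + s k)"
      by (intro norm_mono_nonneg g_nonneg) (simp add: diff_le_eq)
    also have "\<dots> \<le> norm (z k) + norm (s k)"
      by (rule norm_triangle_ineq)
    also have "\<dots> < \<delta>"
      using k norm_s[of k] by simp
    finally show False
      using h(2)[of k] unfolding g_def by simp
  qed
  moreover have "0 \<le> z k" for k
    unfolding z_def by simp
  ultimately show thesis
    by (intro that)
qed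

text \<open>Among all finite index sets \<open>S\<close> for which some \<open>u\<close> in \<open>[0, x]\<close> below every excess with index in \<open>S\<close>
  overlaps the excess sequence in a way that is not norm null, take one of maximal size; sizes are
  bounded because a common part of too many excesses vanishes. Maximality says that, outside \<open>S\<close>,
  the overlaps of \<open>u\<close> with the excesses are asymptotically disjoint.\<close>

lemma disjoint_sequence_of_bounded_positive_series:
  fixes y :: "nat \<Rightarrow> 'a::banach_lattice"
  assumes nonneg: "\<And>n. 0 \<le> y n" and sums: "\<And>S. finite S \<Longrightarrow> (\<Sum>i\<in>S. y i) \<le> x"
    and not_null: "\<not> (\<lambda>n. norm (y n)) \<longlonglongrightarrow> 0"
  obtains z :: "nat \<Rightarrow> 'a" where "\<And>k. 0 \<le> z k" "\<And>k. z k \<le> x" "\<And>j k. j \<noteq> k \<Longrightarrow> inf (z j) (z k) = 0"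
    "\<not> (\<lambda>k. norm (z k)) \<longlonglongrightarrow> 0"
proof -
  obtain \<delta> where \<delta>: "0 < \<delta>" "\<And>N. \<exists>n\<ge>N. \<delta> \<le> norm (y n)"
    using not_norm_null_frequently[OF not_null] by blast
  have "0 \<le> x"
    using sums[of "{}"] by simp
  have y_le: "y n \<le> x" for n
    using sums[of "{n}"] by simp
  \<comment> \<open>Small enough for the cut-off \<open>\<epsilon> x\<close> to have norm at most \<open>\<delta> / 2\<close>; the summand \<open>1\<close> covers \<open>x = 0\<close>.\<close>
  define \<epsilon> where "\<epsilon> = \<delta> / (2 * (norm x + 1))"
  have \<epsilon>: "0 < \<epsilon>" "\<epsilon> * norm x \<le> \<delta> / 2"
    unfolding \<epsilon>_def using \<delta>(1) by (auto simp: field_simps add_pos_nonneg)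
  define v where "v n = pprt (y n - \<epsilon> *\<^sub>R x)" for n
  have v_nonneg: "0 \<le> v n" for n
    unfolding v_def by simp
  have v_le: "v n \<le> x" for n
  proof -
    have "v n \<le> pprt (y n)"
      unfolding v_def using \<epsilon> \<open>0 \<le> x\<close> by (intro pprt_mono) (simp add: scaleR_nonneg_nonneg)
    then show ?thesis
      using nonneg[of n] y_le[of n] by simp
  qed
  have v_not_null: "\<not> (\<lambda>n. norm (v n)) \<longlonglongrightarrow> 0"
  proof
    assume "(\<lambda>n. norm (v n)) \<longlonglongrightarrow> 0"
    then have "\<forall>\<^sub>F n in sequentially. norm (v n) < \<delta>/2"
      using \<delta>(1) by (intro order_tendstoD) auto
    then obtain n where n: "norm (v n) < \<delta>/2" "\<delta> \<le> norm (y n)"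
      using \<delta>(2) unfolding eventually_sequentially by blast
    have "y n - \<epsilon> *\<^sub>R x \<le> v n"
      unfolding v_def pprt_def by simp
    then have "norm (y n) \<le> norm (v n + \<epsilon> *\<^sub>R x)"
      by (intro norm_mono_nonneg nonneg) (simp add: diff_le_eq)
    also have "\<dots> \<le> norm (v n) + \<epsilon> * norm x"
      using norm_triangle_ineq[of "v n" "\<epsilon> *\<^sub>R x"] \<epsilon> by simp
    finally show False
      using n \<epsilon> by simp
  qed
  define good where "good S \<longleftrightarrow> finite S \<and>
    (\<exists>u. 0 \<le> u \<and> u \<le> x \<and> (\<forall>i\<in>S. u \<le> v i) \<and> \<not> (\<lambda>n. norm (inf u (v n))) \<longlonglongrightarrow> 0)" for S
  have "inf x (v n) = v n" for n
    using v_le by (rule inf_absorb2)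
  then have "good {}"
    unfolding good_def using \<open>0 \<le> x\<close> v_not_null by (intro conjI exI[of _ x]) simp_all
  obtain M :: nat where M: "1 / \<epsilon> \<le> real M"
    using real_arch_simple by blast
  have card_le: "card S \<le> M" if "good S" for S
  proof (rule ccontr)
    assume "\<not> card S \<le> M"
    then have "1 / \<epsilon> \<le> real (card S)" "0 < card S"
      using M by auto
    then have card: "0 < card S" "1 \<le> real (card S) * \<epsilon>"
      using \<epsilon> by (auto simp: field_simps)
    obtain u where "finite S" and u: "0 \<le> u" "\<And>i. i \<in> S \<Longrightarrow> u \<le> v i" "\<not> (\<lambda>n. norm (inf u (v n))) \<longlonglongrightarrow> 0"
      using \<open>good S\<close> unfolding good_def by blast
    have "u = 0"
      by (rule common_part_of_excesses_zero[where y = y, OF sums \<open>0 \<le> x\<close> \<open>finite S\<close> card u(1)])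
        (use u(2) in \<open>simp_all add: v_def\<close>)
    then show False
      using u(3) v_nonneg by (simp add: inf_absorb1)
  qed
  have "\<exists>S. good S \<and> (\<forall>T. good T \<longrightarrow> card T \<le> card S)"
    by (rule ex_has_greatest_nat[where P = good and f = card and k = "{}" and b = "Suc M"])
      (use \<open>good {}\<close> card_le in \<open>simp_all add: less_Suc_eq_le\<close>)
  then obtain S where "good S" and max: "\<And>T. good T \<Longrightarrow> card T \<le> card S"
    by blast
  then obtain u where "finite S" and u: "0 \<le> u" "u \<le> x" "\<And>i. i \<in> S \<Longrightarrow> u \<le> v i"
    "\<not> (\<lambda>n. norm (inf u (v n))) \<longlonglongrightarrow> 0"
    unfolding good_def by blast
  define w where "w n = inf u (v n)" for n
  have w_nonneg: "0 \<le> w n" for n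
    unfolding w_def using u v_nonneg by simp
  have asym: "(\<lambda>n. norm (inf (w m) (w n))) \<longlonglongrightarrow> 0" if "m \<notin> S" for m
  proof -
    have "\<not> good (insert m S)"
      using max[of "insert m S"] that \<open>finite S\<close> by auto
    moreover have "w m \<le> x" "w m \<le> v m" "\<And>i. i \<in> S \<Longrightarrow> w m \<le> v i"
      unfolding w_def using u by (auto intro: le_infI1)
    ultimately have "(\<lambda>n. norm (inf (w m) (v n))) \<longlonglongrightarrow> 0"
      using \<open>finite S\<close> w_nonneg[of m] unfolding good_def by blast
    moreover have "inf (w m) (w n) = inf (w m) (v n)" for n
      unfolding w_def by (simp add: inf_assoc inf_left_commute)
    ultimately show ?thesis
      by simp
  qed
  have w_not_null: "\<not> (\<lambda>n. norm (w n)) \<longlonglongrightarrow> 0"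
    using u(4) unfolding w_def .
  obtain z h where z: "\<And>k::nat. 0 \<le> z k" "\<And>k. z k \<le> w (h k)"
    "\<And>j k. j \<noteq> k \<Longrightarrow> inf (z j) (z k) = 0" "\<not> (\<lambda>k. norm (z k)) \<longlonglongrightarrow> 0"
    by (rule disjoint_sequence_of_asymptotically_disjoint[where w = w, OF w_nonneg w_not_null \<open>finite S\<close> asym])
      (assumption, rule that)
  have "z k \<le> x" for k
    using z(2)[of k] u(2) unfolding w_def by (meson inf_le1 order_trans)
  then show thesis
    using that[of z] z by blast
qed

section \<open>Order continuity from the positive Schur property\<close>

text \<open>If the differences of some decreasing sequence in \<open>D\<close> stayed away from zero they would form a
  bounded positive series, from which a disjoint order bounded sequence that is not norm null could be
  extracted. So \<open>D\<close> is a Cauchy net; its limit is a lower bound of \<open>D\<close>, hence zero.\<close>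

lemma order_continuous_norm_of_disjoint_null:
  assumes null: "\<And>(z :: nat \<Rightarrow> 'a::banach_lattice) x. (\<And>k. 0 \<le> z k) \<Longrightarrow> (\<And>k. z k \<le> x) \<Longrightarrow>
    (\<And>j k. j \<noteq> k \<Longrightarrow> inf (z j) (z k) = 0) \<Longrightarrow> (\<lambda>k. norm (z k)) \<longlonglongrightarrow> 0"
  shows "order_continuous_norm TYPE('a)"
  unfolding order_continuous_norm_def
proof (intro allI impI)
  fix D :: "'a set" and e :: real
  assume D: "decreases_to_zero D" and e: "0 < e"
  have nonneg: "0 \<le> a" if "a \<in> D" for a
    using D that unfolding decreases_to_zero_def by blast
  have directed: "\<exists>c\<in>D. c \<le> a \<and> c \<le> b" if "a \<in> D" "b \<in> D" for a b
    using D that unfolding decreases_to_zero_def by blast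
  have cauchy: "\<exists>a\<in>D. \<forall>b\<in>D. b \<le> a \<longrightarrow> norm (a - b) < \<delta>" if \<delta>: "0 < \<delta>" for \<delta> :: real
  proof (rule ccontr)
    assume neg: "\<not> ?thesis"
    have "\<exists>a. \<forall>n. a n \<in> D \<and> (a (Suc n) \<le> a n \<and> \<delta> \<le> norm (a n - a (Suc n)))"
    proof (rule dependent_nat_choice)
      show "\<exists>a. a \<in> D"
        using D unfolding decreases_to_zero_def by blast
      show "\<exists>b. b \<in> D \<and> b \<le> a \<and> \<delta> \<le> norm (a - b)" if "a \<in> D" for a and n :: nat
        using neg that by (auto simp: not_less)
    qed
    then obtain a where a: "\<And>n. a n \<in> D" "\<And>n. a (Suc n) \<le> a n" "\<And>n. \<delta> \<le> norm (a n - a (Suc n))"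
      by blast
    have sums: "(\<Sum>n\<in>S. a n - a (Suc n)) \<le> a 0" if fin: "finite S" for S
    proof -
      obtain N where "S \<subseteq> {..<N}"
        using fin finite_nat_iff_bounded by blast
      then have "(\<Sum>n\<in>S. a n - a (Suc n)) \<le> (\<Sum>n<N. a n - a (Suc n))"
        by (intro sum_mono2) (simp_all add: a(2))
      also have "\<dots> = a 0 - a N"
        by (rule sum_lessThan_telescope')
      also have "\<dots> \<le> a 0"
        using nonneg[OF a(1)[of N]] by simp
      finally show ?thesis .
    qed
    have diff_not_null: "\<not> (\<lambda>n. norm (a n - a (Suc n))) \<longlonglongrightarrow> 0"
    proof
      assume "(\<lambda>n. norm (a n - a (Suc n))) \<longlonglongrightarrow> 0"
      then have "\<delta> \<le> 0"
        by (rule LIMSEQ_le_const) (use a(3) in blast)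
      then show False
        using \<delta> by simp
    qed
    have diff_nonneg: "0 \<le> a n - a (Suc n)" for n
      using a(2) by simp
    obtain z :: "nat \<Rightarrow> 'a" where z: "\<And>k. 0 \<le> z k" "\<And>k. z k \<le> a 0"
      "\<And>j k. j \<noteq> k \<Longrightarrow> inf (z j) (z k) = 0" "\<not> (\<lambda>k. norm (z k)) \<longlonglongrightarrow> 0"
      by (rule disjoint_sequence_of_bounded_positive_series[where y = "\<lambda>n. a n - a (Suc n)",
            OF diff_nonneg sums diff_not_null])
        (assumption, rule that)
    have "(\<lambda>k. norm (z k)) \<longlonglongrightarrow> 0"
      using z(1-3) by (rule null)
    then show False
      using z(4) by contradiction
  qed
  have "\<exists>a. \<forall>n. (a n \<in> D \<and> (\<forall>b\<in>D. b \<le> a n \<longrightarrow> norm (a n - b) \<le> inverse (real (Suc n)))) \<and> a (Suc n) \<le> a n"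
  proof (rule dependent_nat_choice)
    show "\<exists>a. a \<in> D \<and> (\<forall>b\<in>D. b \<le> a \<longrightarrow> norm (a - b) \<le> inverse (real (Suc 0)))"
      using cauchy[of "inverse (real (Suc 0))"] by (auto intro: less_imp_le)
  next
    fix a and n :: nat
    assume a: "a \<in> D \<and> (\<forall>b\<in>D. b \<le> a \<longrightarrow> norm (a - b) \<le> inverse (real (Suc n)))"
    obtain c where c: "c \<in> D" "\<And>b. b \<in> D \<Longrightarrow> b \<le> c \<Longrightarrow> norm (c - b) < inverse (real (Suc (Suc n)))"
      using cauchy[of "inverse (real (Suc (Suc n)))"] by auto
    obtain d where d: "d \<in> D" "d \<le> a" "d \<le> c"
      using directed a c by blast
    have "norm (d - b) \<le> inverse (real (Suc (Suc n)))" if b: "b \<in> D" "b \<le> d" for b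
    proof -
      have "norm (d - b) \<le> norm (c - b)"
        using b d by (intro norm_mono_nonneg) auto
      then show ?thesis
        using c(2)[OF b(1) order_trans[OF b(2) d(3)]] by linarith
    qed
    then show "\<exists>d. (d \<in> D \<and> (\<forall>b\<in>D. b \<le> d \<longrightarrow> norm (d - b) \<le> inverse (real (Suc (Suc n))))) \<and> d \<le> a"
      using d by blast
  qed
  then obtain a where a: "\<And>n. a n \<in> D" "\<And>n. a (Suc n) \<le> a n"
    and a_close: "\<And>n b. b \<in> D \<Longrightarrow> b \<le> a n \<Longrightarrow> norm (a n - b) \<le> inverse (real (Suc n))"
    by metis
  have a_anti: "a n \<le> a m" if "m \<le> n" for m n
    using lift_Suc_antimono_le[of a] a(2) that by blast
  have "Cauchy a"
  proof (rule CauchyI')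
    fix r :: real
    assume "0 < r"
    then obtain N where N: "inverse (real (Suc N)) < r"
      using reals_Archimedean by blast
    have "dist (a m) (a n) < r" if "N \<le> m" "m < n" for m n
    proof -
      have "norm (a m - a n) \<le> norm (a N - a n)"
        using a_anti[of m n] a_anti[of N m] that by (intro norm_mono_nonneg) auto
      also have "\<dots> \<le> inverse (real (Suc N))"
        using a_anti[of N n] that a(1) by (intro a_close) auto
      finally show ?thesis
        using N by (simp add: dist_norm)
    qed
    then show "\<exists>M. \<forall>m\<ge>M. \<forall>n>m. dist (a m) (a n) < r"
      by blast
  qed
  then obtain l where l: "a \<longlonglongrightarrow> l"
    using Cauchy_convergent convergent_def by blast
  have "l \<le> d" if "d \<in> D" for d
  proof -
    \<comment> \<open>Elements of \<open>D\<close> below both \<open>a n\<close> and \<open>d\<close> are close to \<open>a n\<close>, so they also converge to \<open>l\<close>.\<close>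
    have "\<exists>c\<in>D. c \<le> a n \<and> c \<le> d" for n
      using directed a(1) that by blast
    then obtain c where c: "\<And>n. c n \<in> D" "\<And>n. c n \<le> a n" "\<And>n. c n \<le> d"
      by metis
    have "(\<lambda>n. a n - c n) \<longlonglongrightarrow> 0"
      using a_close[OF c(1) c(2)]
      by (intro Lim_null_comparison[OF _ LIMSEQ_inverse_real_of_nat] always_eventually allI)
    then have "(\<lambda>n. a n - (a n - c n)) \<longlonglongrightarrow> l - 0"
      by (intro tendsto_diff l)
    then show ?thesis
      using c(3) by (intro banach_lattice_lim_le[of c l "\<lambda>_. d" d]) auto
  qed
  then have "l \<le> 0"
    using D unfolding decreases_to_zero_def by blast
  moreover have "0 \<le> l"
    using nonneg a(1) by (intro banach_lattice_lim_le[OF tendsto_const l]) auto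
  ultimately have "a \<longlonglongrightarrow> 0"
    using l by simp
  then have "\<forall>\<^sub>F n in sequentially. norm (a n) < e"
    using e by (intro order_tendstoD(2)[OF tendsto_norm_zero])
  then obtain n where n: "norm (a n) < e"
    unfolding eventually_sequentially by blast
  have "norm b < e" if "b \<in> D" "b \<le> a n" for b
    using norm_mono_nonneg[OF nonneg that(2)] that(1) n by simp
  then show "\<exists>x\<in>D. \<forall>y\<in>D. y \<le> x \<longrightarrow> norm y < e"
    using a(1) by blast
qed

section \<open>The characterization\<close>

theorem proposition3p6:
  fixes p :: real
  assumes "p \<ge> 1"
  shows "positive_Schur p TYPE('a::banach_lattice) \<longleftrightarrow>
    order_continuous_norm TYPE('a) \<and> disjoint_DP_star p TYPE('a)"
proof (intro iffI conjI)
  assume schur: "positive_Schur p TYPE('a)"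
  show "order_continuous_norm TYPE('a)"
  proof (rule order_continuous_norm_of_disjoint_null)
    fix z :: "nat \<Rightarrow> 'a" and x
    assume z: "\<And>k. 0 \<le> z k" "\<And>k. z k \<le> x" "\<And>j k. j \<noteq> k \<Longrightarrow> inf (z j) (z k) = 0"
    have "disjoint_seq z"
      unfolding disjoint_seq_def using z by (simp add: abs_of_nonneg)
    moreover have "weakly_p_summable p z"
      using z by (intro weakly_p_summable_disjoint_order_bounded[OF assms, where x = x]) auto
    ultimately show "(\<lambda>k. norm (z k)) \<longlonglongrightarrow> 0"
      using schur unfolding positive_Schur_def by blast
  qed
  show "disjoint_DP_star p TYPE('a)"
    using schur unfolding positive_Schur_def disjoint_DP_star_def
    by (blast intro: limited_range_of_norm_null)
next
  assume "order_continuous_norm TYPE('a) \<and> disjoint_DP_star p TYPE('a)"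
  then have oc: "order_continuous_norm TYPE('a)" and dp: "disjoint_DP_star p TYPE('a)"
    by simp_all
  show "positive_Schur p TYPE('a)"
    unfolding positive_Schur_def
  proof (intro allI impI)
    fix x :: "nat \<Rightarrow> 'a"
    assume x: "disjoint_seq x" "weakly_p_summable p x"
    obtain f where f: "weak_star_null f" "\<And>n. blinfun_apply (f n) (x n) = norm (x n)"
      by (rule disjoint_norming_functionals_weak_star_null[OF oc x(1)]) (rule that)
    have "limited_set (range x)"
      using dp x unfolding disjoint_DP_star_def by blast
    then have unif: "uniform_limit (range x) (\<lambda>n. blinfun_apply (f n)) (\<lambda>_. 0) sequentially"
      using f(1) unfolding limited_set_def by blast
    show "(\<lambda>n. norm (x n)) \<longlonglongrightarrow> 0"
    proof (rule tendstoI)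
      fix e :: real
      assume "0 < e"
      then have "\<forall>\<^sub>F n in sequentially. \<forall>y\<in>range x. dist (f n y) 0 < e"
        by (rule uniform_limitD[OF unif])
      then show "\<forall>\<^sub>F n in sequentially. dist (norm (x n)) 0 < e"
      proof eventually_elim
        case (elim n)
        then have "dist (f n (x n)) 0 < e"
          by blast
        then show ?case
          by (simp add: f(2))
      qed
    qed
  qed
qed

end
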